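(* Let $\{k_i(t)\}_{t=i,i+1,\dots}$ ($i=1,2,\dots$) be non-multiple growing network Markov chains with initial distributions $d_{k,i}$ and transition functions $f_t(k)$. Suppose that for every $k$ the limit $\lim_{i\to\infty}d_{k,i}=d_k$ exists, that $\sum_{k=0}^\infty d_k=1$, and that for every $k$ the (finite) limit $F(k):=\lim_{t\to\infty}t f_t(k)$ exists. Suppose that there is a non-negative integer $m$ such that $d_k=0$ for $k=0,1,\dots,m-1$, $d_m>0$, and $F(k)>0$ for $k=m,m+1,\dots$. Suppose moreover that there is an integer $M\ge m$ with $d_k=0$ for all $k>M$, and that there are two constants $A,B$ with $F(k)=Ak+B$ for all $k$. Write $P(k)=\lim_{t\to\infty}P(k,t)$. Then: (I) The degree distribution $P(k)$ satisfies $\sum_{k=m}^\infty P(k)=1$. (II) If $A>0$, then $\{k_i(t)\}$ are scale-free non-multiple growing network Markov chains, and $$P(k)=\begin{cases}\dfrac{d_m}{1+Am+B}, & k=m,\\[2mm] \displaystyle\prod_{i=m}^{k-1}\frac{Ai+B}{1+A(i+1)+B}\left[\frac{d_m}{1+Am+B}+\sum_{l=m}^{k-1}\frac{\frac{d_{l+1}}{1+A(l+1)+B}}{\prod_{j=m}^{l}\frac{Aj+B}{1+A(j+1)+B}}\right], & m<k\le M,\\[4mm] \displaystyle\frac{\Gamma(k+\frac BA)}{\Gamma(k+\frac BA+1+\frac1A)}\,\frac{\Gamma(M+\frac BA+1+\frac1A)}{\Gamma(M+\frac BA)}\prod_{i=m}^{M-1}\frac{Ai+B}{1+A(i+1)+B}\left[\frac{d_m}{1+Am+B}+\sum_{l=m}^{M-1}\frac{\frac{d_{l+1}}{1+A(l+1)+B}}{\prod_{j=m}^{l}\frac{Aj+B}{1+A(j+1)+B}}\right],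 & k>M,\end{cases}$$ with $P(k)\sim k^{-(1+\frac1A)}$. In particular, if $d_m=1$ and $d_k=0$ for $k\ne m$, then $$P(k)=\begin{cases}\dfrac{1}{1+Am+B}, & k=m,\\[2mm] \displaystyle\frac{\Gamma(k+\frac BA)}{\Gamma(k+\frac BA+1+\frac1A)}\,\frac{\Gamma(m+\frac BA+1+\frac1A)}{\Gamma(m+\frac BA)}\,\frac{1}{1+Am+B}\ \sim\ k^{-(1+\frac1A)}, & k>m.\end{cases}$$ (III) If $A=0$ and $B>0$, then $\{k_i(t)\}$ are not scale-free non-multiple growing network Markov chains. (IV) The cases $A<0$, and $A=0,\ B<0$, cannot occur.
   Context: Non-multiple growing network Markov chains: for each $i=1,2,\dots$, $k_i(t)$ ($t=i,i+1,\dots$) is a Markov chain, non-decreasing in $t$, with values in $\{0,1,2,\dots\}$. There is a positive integer $i_0$ such that for all $i\ge i_0$ the chain has initial distribution $P\{k_i(i)=k\}=d_{k,i}$ and transition probabilities $$P\{k_i(t+1)=l\mid k_i(t)=k\}=\begin{cases} f_t(k), & l=k+1,\\ 1-f_t(k), & l=k,\\ 0,&\text{otherwise,}\end{cases}$$ where $0<f_t(k)<1$ ($f_t(k)$ does not depend on $i$). Notation: $P(k,i,t):=P\{k_i(t)=k\}$ for $t\ge i$, and $P(k,t):=\frac1t\sum_{i=1}^t P(k,i,t)$. Definition: if the limit $P(k)=\lim_{t\to\infty}P(k,t)$ exists for every $k\ge 0$, and $P(k)\ge 0$, $\sum_{k=0}^\infty P(k)=1$, one says that the steady degree distribution of $\{k_i(t)\}$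 exists, and $P(k)$ is called the steady degree distribution. If moreover $P(k)$ is a power law, i.e. $P(k)\sim k^{-\gamma}$ for some constant $\gamma$, the chains are called scale-free. Here $P(k)\sim k^{-\gamma}$ means asymptotic proportionality: $k^{\gamma}P(k)$ converges to a positive finite constant as $k\to\infty$. Empty products equal $1$ and empty sums equal $0$. *)

theory Defs
  imports "HOL-Probability.Probability"
begin

(* A Markov chain (X t) for t = i, i+1, ... . The history {i..t} is a finite set of times and the
   states are countably many, so elementary conditional probabilities suffice. cond_prob is 0 when
   the conditioning event is null, hence the guard. *)
definition markov_chain_from :: "'a measure \<Rightarrow> nat \<Rightarrow> (nat \<Rightarrow> 'a \<Rightarrow> nat) \<Rightarrow> bool" where
  "markov_chain_from \<Omega> i X \<longleftrightarrow>
     (\<forall>t\<ge>i. X t \<in> measurable \<Omega> (count_space UNIV)) \<and>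
     (\<forall>t\<ge>i. \<forall>x l.
        \<P>(\<omega> in \<Omega>. \<forall>s\<in>{i..t}. X s \<omega> = x s) > 0 \<longrightarrow>
        \<P>(\<omega> in \<Omega>. X (Suc t) \<omega> = l \<bar> (\<forall>s\<in>{i..t}. X s \<omega> = x s))
          = \<P>(\<omega> in \<Omega>. X (Suc t) \<omega> = l \<bar> X t \<omega> = x t))"

(* K i t is k_i(t), relevant only for 1 \<le> i \<le> t; dist0 k i is d_{k,i}; f t k is f_t(k).
   Nothing is assumed about the joint law of chains with different i. Monotonicity in t is required
   almost surely. The bounds on f are required where f occurs as a transition function, t \<ge> i0. *)
definition non_multiple_growing_network ::
  "'a measure \<Rightarrow> (nat \<Rightarrow> nat \<Rightarrow> 'a \<Rightarrow> nat) \<Rightarrow> (nat \<Rightarrow> nat \<Rightarrow> real) \<Rightarrow> (nat \<Rightarrow> nat \<Rightarrow> real) \<Rightarrow> bool" where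
  "non_multiple_growing_network \<Omega> K dist0 f \<longleftrightarrow>
     prob_space \<Omega> \<and>
     (\<forall>i\<ge>1. markov_chain_from \<Omega> i (K i) \<and>
             (\<forall>t\<ge>i. AE \<omega> in \<Omega>. K i t \<omega> \<le> K i (Suc t) \<omega>)) \<and>
     (\<exists>i0\<ge>1.
        (\<forall>t\<ge>i0. \<forall>k. 0 < f t k \<and> f t k < 1) \<and>
        (\<forall>i\<ge>i0.
           (\<forall>k. \<P>(\<omega> in \<Omega>. K i i \<omega> = k) = dist0 k i) \<and>
           (\<forall>t\<ge>i. \<forall>k l. \<P>(\<omega> in \<Omega>. K i t \<omega> = k) > 0 \<longrightarrow>
              \<P>(\<omega> in \<Omega>. K i (Suc t) \<omega> = l \<bar> K i t \<omega> = k)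
                = (if l = Suc k then f t k else if l = k then 1 - f t k else 0))))"

definition mean_degree_prob :: "'a measure \<Rightarrow> (nat \<Rightarrow> nat \<Rightarrow> 'a \<Rightarrow> nat) \<Rightarrow> nat \<Rightarrow> nat \<Rightarrow> real" where
  "mean_degree_prob \<Omega> K k t = (1 / real t) * (\<Sum>i=1..t. \<P>(\<omega> in \<Omega>. K i t \<omega> = k))"

(* Meaningful only where the limit exists; steady_degree_distribution asserts that it does. *)
definition degree_distribution :: "'a measure \<Rightarrow> (nat \<Rightarrow> nat \<Rightarrow> 'a \<Rightarrow> nat) \<Rightarrow> nat \<Rightarrow> real" where
  "degree_distribution \<Omega> K k = lim (\<lambda>t. mean_degree_prob \<Omega> K k t)"

definition steady_degree_distribution ::
  "'a measure \<Rightarrow> (nat \<Rightarrow> nat \<Rightarrow> 'a \<Rightarrow> nat) \<Rightarrow> (nat \<Rightarrow> real) \<Rightarrow> bool" where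
  "steady_degree_distribution \<Omega> K P \<longleftrightarrow>
     (\<forall>k. (\<lambda>t. mean_degree_prob \<Omega> K k t) \<longlonglongrightarrow> P k) \<and> (\<forall>k. P k \<ge> 0) \<and> P sums 1"

(* P(k) ~ k^(-\<gamma>) in the sense of asymptotic proportionality *)
definition power_law :: "(nat \<Rightarrow> real) \<Rightarrow> real \<Rightarrow> bool" where
  "power_law P \<gamma> \<longleftrightarrow> (\<exists>c>0. (\<lambda>k. real k powr \<gamma> * P k) \<longlonglongrightarrow> c)"

definition scale_free :: "'a measure \<Rightarrow> (nat \<Rightarrow> nat \<Rightarrow> 'a \<Rightarrow> nat) \<Rightarrow> bool" where
  "scale_free \<Omega> K \<longleftrightarrow> (\<exists>P. steady_degree_distribution \<Omega> K P \<and> (\<exists>\<gamma>. power_law P \<gamma>))"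

end

theory Submission imports Defs "HOL-Real_Asymp.Real_Asymp" begin

text \<open>
  Summing the one-step transition law over the starting times gives, for the expected number
  \<open>S k t\<close> of chains in state \<open>k\<close> at time \<open>t\<close>, the recursion
  \<open>S k (t+1) = (1 - f t k) * S k t + f t (k-1) * S (k-1) t + dist0 k (t+1)\<close>. Since
  \<open>t * f t k\<close> converges to \<open>F k\<close>, \<open>S k t / t\<close> converges to the solution of
  \<open>(1 + F k) * P k = F (k-1) * P (k-1) + d k\<close>. Positivity of \<open>f\<close> forces \<open>F \<ge> 0\<close>, hence
  \<open>A \<ge> 0\<close> and \<open>B \<ge> 0\<close>; linearity of \<open>F\<close> then prevents mass from escaping to infinity.
  Beyond \<open>M\<close> the solution is a product of ratios \<open>F i / (1 + F (i+1))\<close>: a quotient of Gamma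
  functions if \<open>A > 0\<close>, and geometric if \<open>A = 0\<close>.
\<close>

section \<open>Growth rate of a linear recurrence\<close>

text \<open>The slope \<open>L\<close> is the solution of \<open>L = \<beta> - L * F\<close>. The
  deviation \<open>y\<close> from the line \<open>L * t\<close> obeys the same recurrence with
  source \<open>e\<close> tending to 0. Since \<open>0 \<le> f t \<le> 1\<close>, the factor
  \<open>1 - f t\<close> never enlarges \<open>y\<close>, so \<open>y\<close> grows by at most
  \<open>\<bar>e t\<bar>\<close> per step and is o(t).\<close>

lemma tendsto_div_linear_recurrence:
  fixes x f b :: "nat \<Rightarrow> real"
  assumes rec: "\<And>t. t \<ge> T \<Longrightarrow> x (Suc t) = (1 - f t) * x t + b t"
    and f: "\<And>t. t \<ge> T \<Longrightarrow> 0 \<le> f t \<and> f t \<le> 1"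
    and F: "(\<lambda>t. real t * f t) \<longlonglongrightarrow> F" and "F \<ge> 0"
    and b: "b \<longlonglongrightarrow> \<beta>"
  shows "(\<lambda>t. x t / real t) \<longlonglongrightarrow> \<beta> / (1 + F)"
proof -
  define L where "L = \<beta> / (1 + F)"
  define y where "y t = x t - L * real t" for t
  define e where "e t = b t - L * (real t * f t) - L" for t
  have "e \<longlonglongrightarrow> \<beta> - L * F - L"
    unfolding e_def by (intro tendsto_intros F b)
  also have "\<beta> - L * F - L = 0"
    using \<open>F \<ge> 0\<close> by (simp add: L_def divide_simps) (simp add: algebra_simps)
  finally have e0: "e \<longlonglongrightarrow> 0" .
  have y_Suc: "\<bar>y (Suc t)\<bar> \<le> \<bar>y t\<bar> + \<bar>e t\<bar>" if "t \<ge> T" for t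
  proof -
    have "y (Suc t) = (1 - f t) * y t + e t"
      using rec[OF that] by (simp add: y_def e_def algebra_simps)
    also have "\<bar>\<dots>\<bar> \<le> \<bar>1 - f t\<bar> * \<bar>y t\<bar> + \<bar>e t\<bar>"
      by (metis abs_mult abs_triangle_ineq)
    also have "\<bar>1 - f t\<bar> * \<bar>y t\<bar> \<le> 1 * \<bar>y t\<bar>"
      using f[OF that] by (intro mult_right_mono) auto
    finally show ?thesis by simp
  qed
  have "(\<lambda>t. y t / real t) \<longlonglongrightarrow> 0"
  proof (rule LIMSEQ_I)
    fix r :: real assume "r > 0"
    with e0 have "\<forall>\<^sub>F t in sequentially. \<bar>e t\<bar> < r / 2"
      by (auto simp: tendsto_iff dist_real_def dest!: spec[of _ "r / 2"])
    then obtain N0 where N0: "\<And>t. t \<ge> N0 \<Longrightarrow> \<bar>e t\<bar> < r / 2"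
      by (auto simp: eventually_sequentially)
    define N where "N = max T N0"
    have bound: "\<bar>y t\<bar> \<le> \<bar>y N\<bar> + r / 2 * real (t - N)" if "t \<ge> N" for t
      using that
    proof (induction t rule: dec_induct)
      case (step n)
      have "n \<ge> T" "n \<ge> N0" using step.hyps by (auto simp: N_def)
      then have "\<bar>y (Suc n)\<bar> \<le> \<bar>y n\<bar> + r / 2"
        using y_Suc[of n] N0[of n] by linarith
      moreover have "real (Suc n - N) = real (n - N) + 1" using step.hyps by (simp add: Suc_diff_le)
      ultimately show ?case using step.IH by (simp only: distrib_left)
    qed simp
    \<comment> \<open>The first bound gives \<open>t > 0\<close> and \<open>t \<ge> N\<close>; the
      second makes the starting value \<open>\<bar>y N\<bar>\<close> smaller than the half of
      \<open>r * t\<close> that the increments leave over.\<close>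
    have "norm (y t / real t - 0) < r" if "t \<ge> max (N + 1) (nat \<lceil>2 * \<bar>y N\<bar> / r\<rceil> + 1)" for t
    proof -
      have t: "t \<ge> N" "t > 0" "real t > 2 * \<bar>y N\<bar> / r" using that by linarith+
      from t(3) have "\<bar>y N\<bar> < r / 2 * real t" using \<open>r > 0\<close> by (simp add: field_simps)
      moreover have "r / 2 * real (t - N) \<le> r / 2 * real t"
        using \<open>r > 0\<close> by (intro mult_left_mono) auto
      ultimately have "\<bar>y t\<bar> < r * real t" using bound[OF t(1)] by linarith
      then show ?thesis using t(2) by (simp add: field_simps)
    qed
    then show "\<exists>no. \<forall>n\<ge>no. norm (y n / real n - 0) < r" by blast
  qed
  then have "(\<lambda>t. y t / real t + L) \<longlonglongrightarrow> 0 + L" by (intro tendsto_intros)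
  moreover have "\<forall>\<^sub>F t in sequentially. y t / real t + L = x t / real t"
    using eventually_gt_at_top[of 0] by eventually_elim (simp add: y_def field_simps)
  ultimately show ?thesis unfolding L_def[symmetric] by (simp add: Lim_transform_eventually)
qed

section \<open>The one-step law of a growing chain\<close>

text \<open>Total probability over the countably many values of \<open>X\<close>: only
  \<open>k = l\<close> and its predecessor can lead to \<open>Y = l\<close>.\<close>

lemma (in prob_space) prob_growth_step:
  fixes X Y :: "'a \<Rightarrow> nat" and g :: "nat \<Rightarrow> real"
  assumes [measurable]: "X \<in> measurable M (count_space UNIV)" "Y \<in> measurable M (count_space UNIV)"
    and trans: "\<And>k l. \<P>(\<omega> in M. X \<omega> = k) > 0 \<Longrightarrow>
      \<P>(\<omega> in M. Y \<omega> = l \<bar> X \<omega> = k) = (if l = Suc k then g k else if l = k then 1 - g k else 0)"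
  shows "\<P>(\<omega> in M. Y \<omega> = l) = (1 - g l) * \<P>(\<omega> in M. X \<omega> = l) +
    (case l of 0 \<Rightarrow> 0 | Suc k \<Rightarrow> g k * \<P>(\<omega> in M. X \<omega> = k))"
proof -
  define p where "p k = \<P>(\<omega> in M. X \<omega> = k)" for k
  define q where "q k = \<P>(\<omega> in M. Y \<omega> = l \<and> X \<omega> = k)" for k
  have q: "q k = (if l = Suc k then g k else if l = k then 1 - g k else 0) * p k" for k
  proof (cases "p k > 0")
    case True
    then show ?thesis using trans[of k l] by (simp add: cond_prob_def p_def q_def field_simps)
  next
    \<comment> \<open>On a null state \<open>trans\<close> is silent, but the joint probability is
      squeezed to 0, so the product formula persists.\<close>
    case False
    then have "p k = 0" unfolding p_def by (simp add: zero_less_measure_iff)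
    moreover have "q k \<le> p k" unfolding p_def q_def by (intro finite_measure_mono) auto
    moreover have "q k \<ge> 0" unfolding q_def by simp
    ultimately show ?thesis by simp
  qed
  have "(\<lambda>k. measure M {\<omega> \<in> space M. Y \<omega> = l \<and> X \<omega> = k}) sums
      measure M (\<Union>k. {\<omega> \<in> space M. Y \<omega> = l \<and> X \<omega> = k})"
    by (intro finite_measure_UNION) (auto simp: disjoint_family_on_def)
  also have "(\<Union>k. {\<omega> \<in> space M. Y \<omega> = l \<and> X \<omega> = k}) = {\<omega> \<in> space M. Y \<omega> = l}" by auto
  finally have "q sums \<P>(\<omega> in M. Y \<omega> = l)" by (simp add: q_def[abs_def])
  \<comment> \<open>For \<open>l = 0\<close> truncated subtraction makes the set
    \<open>{l, l - 1}\<close> collapse to \<open>{0}\<close>, so no term is counted twice.\<close>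
  moreover have "q sums (\<Sum>k\<in>{l, l - 1}. q k)"
    by (intro sums_finite) (auto simp: q)
  ultimately have "\<P>(\<omega> in M. Y \<omega> = l) = (\<Sum>k\<in>{l, l - 1}. q k)" by (rule sums_unique2)
  then show ?thesis by (cases l) (auto simp: q p_def)
qed

section \<open>The limiting recursion and its total mass\<close>

text \<open>The recursive form divides only by \<open>1 + F k\<close>, so it stays meaningful where
  \<open>F\<close> vanishes, as at 0 when \<open>B = 0\<close>.\<close>

primrec steady_weight :: "(nat \<Rightarrow> real) \<Rightarrow> (nat \<Rightarrow> real) \<Rightarrow> nat \<Rightarrow> real" where
  "steady_weight d F 0 = d 0 / (1 + F 0)"
| "steady_weight d F (Suc k) = (F k * steady_weight d F k + d (Suc k)) / (1 + F (Suc k))"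

lemma steady_weight_nonneg:
  assumes "\<And>k. F k \<ge> 0" "\<And>k. d k \<ge> 0"
  shows "steady_weight d F k \<ge> 0"
  by (induction k) (use assms in \<open>auto intro!: divide_nonneg_nonneg add_nonneg_nonneg\<close>)

lemma steady_weight_eq_0:
  assumes "\<And>k. k < m \<Longrightarrow> d k = 0" "k < m"
  shows "steady_weight d F k = 0"
  using assms(2) by (induction k) (use assms(1) in auto)

lemma steady_weight_first:
  assumes "\<And>k. k < m \<Longrightarrow> d k = 0"
  shows "steady_weight d F m = d m / (1 + F m)"
  by (cases m) (use steady_weight_eq_0[of m d _ F] assms in auto)

text \<open>Multiplying the recursion by \<open>1 + F k\<close> turns it into a balance of inflow
  and outflow, which telescopes. What remains, \<open>F n * steady_weight d F n\<close>, is the flow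
  out of the states up to \<open>n\<close>.\<close>

lemma steady_weight_partial_sum:
  assumes F: "\<And>k. F k \<ge> 0"
  shows "(\<Sum>k\<le>n. steady_weight d F k) + F n * steady_weight d F n = (\<Sum>k\<le>n. d k)"
proof (induction n)
  case 0
  have "1 + F 0 > 0" using F[of 0] by linarith
  then have "steady_weight d F 0 * (1 + F 0) = d 0" by simp
  then show ?case by (simp add: algebra_simps del: steady_weight.simps)
next
  case (Suc n)
  have "1 + F (Suc n) > 0" using F[of "Suc n"] by linarith
  then have "steady_weight d F (Suc n) * (1 + F (Suc n)) = F n * steady_weight d F n + d (Suc n)"
    by simp
  with Suc show ?case by (simp add: algebra_simps del: steady_weight.simps)
qed

text \<open>The defect \<open>F n * P n\<close> in the partial sums converges; a positive limit would make \<open>P\<close>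
  comparable to \<open>1 / (1 + F n)\<close>, contradicting summability.\<close>

lemma steady_weight_sums:
  assumes F: "\<And>k. F k \<ge> 0" and d: "\<And>k. d k \<ge> 0" and ds: "d sums s"
    and ns: "\<not> summable (\<lambda>k. 1 / (1 + F k))"
  shows "steady_weight d F sums s"
proof -
  let ?P = "steady_weight d F"
  note nonneg = steady_weight_nonneg[of F d, OF F d]
  have "(\<Sum>k\<le>n. ?P k) \<le> s" for n
  proof -
    have "(\<Sum>k\<le>n. ?P k) \<le> (\<Sum>k\<le>n. d k)"
      using steady_weight_partial_sum[of F d n, OF F] F[of n] nonneg[of n]
      by (smt (verit) mult_nonneg_nonneg)
    also have "\<dots> \<le> s" using ds d
      by (metis finite_atMost sum_le_suminf sums_unique sums_summable)
    finally show ?thesis .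
  qed
  then have sm: "summable ?P" using nonneg by (intro bounded_imp_summable)
  have "(\<lambda>n. (\<Sum>k\<le>n. d k) - (\<Sum>k\<le>n. ?P k)) \<longlonglongrightarrow> s - suminf ?P"
    using ds sm by (intro tendsto_diff) (auto simp: sums_def_le summable_sums dest!: summable_LIMSEQ')
  also have "(\<lambda>n. (\<Sum>k\<le>n. d k) - (\<Sum>k\<le>n. ?P k)) = (\<lambda>n. F n * ?P n)"
    using steady_weight_partial_sum[of F d, OF F] by (auto simp: algebra_simps fun_eq_iff)
  finally have lim: "(\<lambda>n. F n * ?P n) \<longlonglongrightarrow> s - suminf ?P" .
  have ge: "s - suminf ?P \<ge> 0"
    using lim by (rule LIMSEQ_le_const) (use F nonneg in auto)
  have "s - suminf ?P = 0"
  proof (rule ccontr)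
    assume "s - suminf ?P \<noteq> 0"
    define c where "c = s - suminf ?P"
    have "c > 0" using ge \<open>s - suminf ?P \<noteq> 0\<close> unfolding c_def by linarith
    \<comment> \<open>Adding \<open>?P n\<close>, which tends to 0, bounds
      \<open>(1 + F n) * ?P n\<close> from below, so the division is by \<open>1 + F n\<close> and
      not by a possibly zero \<open>F n\<close>.\<close>
    have "(\<lambda>n. ?P n + F n * ?P n) \<longlonglongrightarrow> 0 + c"
      unfolding c_def by (intro tendsto_add lim summable_LIMSEQ_zero sm)
    then have "\<forall>\<^sub>F n in sequentially. ?P n + F n * ?P n > c / 2"
      using \<open>c > 0\<close> by (intro order_tendstoD(1)) auto
    then have "\<forall>\<^sub>F n in sequentially. norm (1 / (1 + F n)) \<le> 2 / c * ?P n"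
    proof eventually_elim
      case (elim n)
      have "1 + F n > 0" using F[of n] by linarith
      with elim \<open>c > 0\<close> show ?case by (simp add: field_simps)
    qed
    then have "summable (\<lambda>n. 1 / (1 + F n))"
      by (rule summable_comparison_test_ev) (intro summable_mult sm)
    with ns show False by contradiction
  qed
  with sm show ?thesis by (simp add: sums_iff)
qed

text \<open>Comparison with the harmonic series, through
  \<open>1 + A * k + B \<le> (1 + A + B) * (1 + k)\<close>. It supplies the divergence required by
  \<open>steady_weight_sums\<close>.\<close>

lemma not_summable_inverse_linear:
  fixes A B :: real
  assumes "A \<ge> 0" "B \<ge> 0"
  shows "\<not> summable (\<lambda>k. 1 / (1 + (A * real k + B)))"
proof
  assume "summable (\<lambda>k. 1 / (1 + (A * real k + B)))"
  then have "summable (\<lambda>k. (1 + A + B) * (1 / (1 + (A * real k + B))))"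
    by (rule summable_mult)
  moreover have "norm (inverse (real (Suc k))) \<le> (1 + A + B) * (1 / (1 + (A * real k + B)))" for k
  proof -
    have "A * real k \<ge> 0" "B * real k \<ge> 0" using assms by auto
    then have "1 + (A * real k + B) \<le> (1 + A + B) * (1 + real k)"
      using assms by (simp add: algebra_simps)
    moreover have "1 + (A * real k + B) > 0"
      using \<open>A * real k \<ge> 0\<close> \<open>B \<ge> 0\<close> by linarith
    ultimately show ?thesis by (simp add: field_simps)
  qed
  ultimately have "summable (\<lambda>k. inverse (real (Suc k)))"
    by (rule summable_comparison_test'[where N = 0])
  then show False using not_summable_harmonic[where 'a = real]
      summable_Suc_iff[of "\<lambda>k. inverse (real k)"] by blast
qed

section \<open>Closed forms: products and Gamma quotients\<close>

text \<open>Variation of constants: divided by the solution of the homogeneous recursion, which is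
  nonzero from \<open>m\<close> on, the weights become partial sums of the rescaled sources.\<close>

lemma steady_weight_product_formula:
  assumes F: "\<And>k. k \<ge> m \<Longrightarrow> F k > 0" and d0: "\<And>k. k < m \<Longrightarrow> d k = 0" and "m \<le> k"
  shows "steady_weight d F k = (\<Prod>i=m..<k. F i / (1 + F (Suc i))) *
    (d m / (1 + F m) + (\<Sum>l=m..<k. (d (l + 1) / (1 + F (Suc l))) / (\<Prod>j=m..l. F j / (1 + F (Suc j)))))"
  using \<open>m \<le> k\<close>
proof (induction k rule: dec_induct)
  case base
  show ?case using steady_weight_first[of m d F, OF d0] by simp
next
  case (step n)
  define Q where "Q = (\<Prod>i=m..<n. F i / (1 + F (Suc i)))"
  define r where "r = F n / (1 + F (Suc n))"
  have "r > 0" using F[of n] F[of "Suc n"] step.hyps by (simp add: r_def)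
  have "Q > 0" unfolding Q_def
  proof (intro prod_pos ballI)
    fix i assume "i \<in> {m..<n}"
    then show "F i / (1 + F (Suc i)) > 0" using F[of i] F[of "Suc i"] by simp
  qed
  have Q: "(\<Prod>i=m..<Suc n. F i / (1 + F (Suc i))) = Q * r" "(\<Prod>i=m..n. F i / (1 + F (Suc i))) = Q * r"
    using step.hyps by (simp_all add: Q_def r_def flip: atLeastLessThanSuc_atLeastAtMost)
  have "steady_weight d F (Suc n) = r * steady_weight d F n + d (Suc n) / (1 + F (Suc n))"
    by (simp add: r_def add_divide_distrib)
  \<comment> \<open>Brings the new source term inside the bracket, behind the extended
    product.\<close>
  moreover have "x = Q * r * (x / (Q * r))" for x :: real
    using \<open>r > 0\<close> \<open>Q > 0\<close> by simp
  ultimately show ?case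
    using step.hyps by (simp only: step.IH Q Q_def[symmetric] sum.atLeastLessThan_Suc distrib_left
        mult_ac Suc_eq_plus1[symmetric])
qed

lemma steady_weight_product_tail:
  assumes "\<And>k. k > M \<Longrightarrow> d k = 0" and "M \<le> k"
  shows "steady_weight d F k = (\<Prod>i=M..<k. F i / (1 + F (Suc i))) * steady_weight d F M"
  using \<open>M \<le> k\<close> by (induction k rule: dec_induct) (use assms(1) in auto)

text \<open>Cancelling \<open>A\<close>, each factor is
  \<open>(i + B / A) / (i + B / A + 1 + 1 / A)\<close>; the functional equation of Gamma makes the
  product telescope. Positivity at \<open>M\<close> keeps all arguments away from the poles.\<close>

lemma prod_linear_eq_Gamma:
  fixes A B :: real
  assumes "A > 0" "A * real M + B > 0" "M \<le> k"
  shows "(\<Prod>i=M..<k. (A * real i + B) / (1 + (A * real (Suc i) + B))) =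
    Gamma (real k + B / A) / Gamma (real k + B / A + 1 + 1 / A) *
    (Gamma (real M + B / A + 1 + 1 / A) / Gamma (real M + B / A))"
proof -
  have pos: "real n + B / A > 0" if "n \<ge> M" for n
  proof -
    have "real M + B / A > 0" using assms(1,2) by (simp add: field_simps)
    then show ?thesis using that by simp
  qed
  have pos': "real n + B / A + 1 + 1 / A > 0" if "n \<ge> M" for n
    using pos[OF that] \<open>A > 0\<close> by (smt (verit) divide_pos_pos)
  show ?thesis using \<open>M \<le> k\<close>
  proof (induction k rule: dec_induct)
    case base
    show ?case using Gamma_real_pos[OF pos[of M]] Gamma_real_pos[OF pos'[of M]] by simp
  next
    case (step n)
    have 1: "Gamma (real (Suc n) + B / A) = (real n + B / A) * Gamma (real n + B / A)"
      using Gamma_plus1[of "real n + B / A"] pos[OF step.hyps(1)]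
      by (simp add: add_ac nonpos_Ints_def)
    have 2: "Gamma (real (Suc n) + B / A + 1 + 1 / A) =
        (real n + B / A + 1 + 1 / A) * Gamma (real n + B / A + 1 + 1 / A)"
      using Gamma_plus1[of "real n + B / A + 1 + 1 / A"] pos'[OF step.hyps(1)]
      by (simp add: add_ac nonpos_Ints_def)
    have 3: "(A * real n + B) / (1 + (A * real (Suc n) + B)) =
        (real n + B / A) / (real n + B / A + 1 + 1 / A)"
    proof -
      have "A * real n + B = A * (real n + B / A)"
        "1 + (A * real (Suc n) + B) = A * (real n + B / A + 1 + 1 / A)"
        using \<open>A > 0\<close> by (simp_all add: field_simps)
      then show ?thesis using \<open>A > 0\<close> by simp
    qed
    show ?case using step.hyps unfolding 1 2
      by (simp add: step.IH 3 mult_ac del: of_nat_Suc)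
  qed
qed

text \<open>Writing \<open>Gamma (n + z)\<close> as \<open>pochhammer z n * Gamma z\<close> exhibits
  the expression as a ratio of two of the approximants \<open>Gamma_series'\<close>; their
  factorials cancel and their exponentials combine to the power of \<open>n\<close>.\<close>

lemma Gamma_quotient_asymp:
  fixes a c :: real
  assumes "a > 0" "c > 0"
  shows "(\<lambda>n. real n powr (c - a) * (Gamma (real n + a) / Gamma (real n + c))) \<longlonglongrightarrow> 1"
proof -
  have [simp]: "a \<notin> \<int>\<^sub>\<le>\<^sub>0" "c \<notin> \<int>\<^sub>\<le>\<^sub>0" using assms by (auto elim!: nonpos_Ints_cases)
  have nz: "Gamma a > 0" "Gamma c > 0" using assms by (auto intro: Gamma_real_pos)
  have "(\<lambda>n. Gamma a / Gamma c * (Gamma_series' c n / Gamma_series' a n)) \<longlonglongrightarrow>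
      Gamma a / Gamma c * (Gamma c / Gamma a)"
    using nz by (intro tendsto_intros Gamma_series'_LIMSEQ) auto
  also have "Gamma a / Gamma c * (Gamma c / Gamma a) = 1" using nz by simp
  finally show ?thesis
  proof (rule Lim_transform_eventually)
    show "\<forall>\<^sub>F n in sequentially. Gamma a / Gamma c * (Gamma_series' c n / Gamma_series' a n) =
        real n powr (c - a) * (Gamma (real n + a) / Gamma (real n + c))"
      using eventually_gt_at_top[of 0]
    proof eventually_elim
      case (elim n)
      have "pochhammer a n > 0" "pochhammer c n > 0" using assms by (auto intro: pochhammer_pos)
      moreover have "Gamma (real n + z) = pochhammer z n * Gamma z" if "z > 0" for z
      proof -
        have "z \<notin> \<int>\<^sub>\<le>\<^sub>0" using that by (auto elim!: nonpos_Ints_cases)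
        then show ?thesis
          using pochhammer_Gamma[of z n] Gamma_real_pos[OF that] by (simp add: add_ac)
      qed
      ultimately show ?case using elim assms
        by (simp add: Gamma_series'_def powr_def exp_diff algebra_simps divide_simps)
    qed
  qed
qed

section \<open>Power laws and geometric tails\<close>

lemma power_law_cong:
  assumes "eventually (\<lambda>k. p k = q k) sequentially"
  shows "power_law p \<gamma> \<longleftrightarrow> power_law q \<gamma>"
proof -
  have "(\<lambda>k. real k powr \<gamma> * p k) \<longlonglongrightarrow> c \<longleftrightarrow> (\<lambda>k. real k powr \<gamma> * q k) \<longlonglongrightarrow> c" for c
    using assms by (intro filterlim_cong refl) (auto elim: eventually_mono)
  then show ?thesis by (simp add: power_law_def)
qed

text \<open>The index is shifted by one because \<open>Gamma_quotient_asymp\<close> excludes \<open>a = 0\<close>, where \<open>Gamma\<close> has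
  a pole.\<close>

lemma power_law_Gamma_quotient:
  fixes a c C :: real
  assumes "a \<ge> 0" "c \<ge> 0" "C > 0"
  shows "power_law (\<lambda>k. Gamma (real k + a) / Gamma (real k + c) * C) (c - a)"
proof -
  \<comment> \<open>This factor trades the power of \<open>n\<close> given by
    \<open>Gamma_quotient_asymp\<close> for the power of \<open>Suc n\<close> that the shift
    requires.\<close>
  have "(\<lambda>n. (real (Suc n) / real n) powr (c - a)) \<longlonglongrightarrow> 1 powr (c - a)"
    by (intro tendsto_intros LIMSEQ_Suc_n_over_n) auto
  then have "(\<lambda>n. (real (Suc n) / real n) powr (c - a) *
      (real n powr ((c + 1) - (a + 1)) * (Gamma (real n + (a + 1)) / Gamma (real n + (c + 1)))) * C)
      \<longlonglongrightarrow> 1 powr (c - a) * 1 * C"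
    by (intro tendsto_mult tendsto_const Gamma_quotient_asymp) (use assms in auto)
  moreover have "\<forall>\<^sub>F n in sequentially. (real (Suc n) / real n) powr (c - a) *
      (real n powr ((c + 1) - (a + 1)) * (Gamma (real n + (a + 1)) / Gamma (real n + (c + 1)))) * C =
      real (Suc n) powr (c - a) * (Gamma (real (Suc n) + a) / Gamma (real (Suc n) + c) * C)"
    using eventually_gt_at_top[of 0]
  proof eventually_elim
    case (elim n)
    then have "(real (Suc n) / real n) powr (c - a) * real n powr ((c + 1) - (a + 1)) =
        real (Suc n) powr (c - a)"
      by (simp add: powr_divide)
    moreover have "real n + (a + 1) = real (Suc n) + a" "real n + (c + 1) = real (Suc n) + c" by auto
    ultimately show ?case by (metis mult.assoc)
  qed
  ultimately have "(\<lambda>n. real (Suc n) powr (c - a) * (Gamma (real (Suc n) + a) / Gamma (real (Suc n) + c) * C))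
      \<longlonglongrightarrow> 1 powr (c - a) * 1 * C"
    by (rule Lim_transform_eventually)
  then have "(\<lambda>n. real n powr (c - a) * (Gamma (real n + a) / Gamma (real n + c) * C)) \<longlonglongrightarrow> C"
    by (subst (asm) filterlim_sequentially_Suc) simp
  then show ?thesis using \<open>C > 0\<close> by (auto simp: power_law_def)
qed

text \<open>Exponential decay beats every power, so the rescaled sequence tends to 0, whereas
  \<open>power_law\<close> demands a positive limit.\<close>

lemma not_power_law_geometric:
  fixes q C :: real
  assumes "0 < q" "q < 1"
  shows "\<not> power_law (\<lambda>k. q ^ k * C) \<gamma>"
proof
  assume "power_law (\<lambda>k. q ^ k * C) \<gamma>"
  then obtain c where c: "c > 0" "(\<lambda>k. real k powr \<gamma> * (q ^ k * C)) \<longlonglongrightarrow> c"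
    by (auto simp: power_law_def)
  define a where "a = - ln q"
  have "a > 0" using assms by (simp add: a_def)
  then have "(\<lambda>k. real k powr \<gamma> * exp (- a * real k)) \<longlonglongrightarrow> 0" by real_asymp
  also have "(\<lambda>k. real k powr \<gamma> * exp (- a * real k)) = (\<lambda>k. real k powr \<gamma> * q ^ k)"
    using assms by (simp add: a_def exp_of_nat2_mult)
  finally have "(\<lambda>k. real k powr \<gamma> * q ^ k) \<longlonglongrightarrow> 0" .
  then have "(\<lambda>k. real k powr \<gamma> * q ^ k * C) \<longlonglongrightarrow> 0 * C" by (intro tendsto_intros)
  then have "(\<lambda>k. real k powr \<gamma> * (q ^ k * C)) \<longlonglongrightarrow> 0" by (simp add: mult.assoc)
  from LIMSEQ_unique[OF c(2) this] have "c = 0" .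
  with c(1) show False by simp
qed

section \<open>From the chains to the limiting recursion\<close>

lemma non_multiple_growing_networkE:
  assumes "non_multiple_growing_network \<Omega> K dist0 f"
  obtains i0 where "i0 \<ge> 1"
    "\<And>t k. t \<ge> i0 \<Longrightarrow> 0 < f t k \<and> f t k < 1"
    "\<And>i k. i \<ge> i0 \<Longrightarrow> \<P>(\<omega> in \<Omega>. K i i \<omega> = k) = dist0 k i"
    "\<And>i t k l. i \<ge> i0 \<Longrightarrow> t \<ge> i \<Longrightarrow> \<P>(\<omega> in \<Omega>. K i t \<omega> = k) > 0 \<Longrightarrow>
      \<P>(\<omega> in \<Omega>. K i (Suc t) \<omega> = l \<bar> K i t \<omega> = k)
        = (if l = Suc k then f t k else if l = k then 1 - f t k else 0)"
proof -
  from assms[unfolded non_multiple_growing_network_def, THEN conjunct2, THEN conjunct2]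
  obtain i0 where i0: "i0 \<ge> 1" "\<forall>t\<ge>i0. \<forall>k. 0 < f t k \<and> f t k < 1" and
    ch: "\<forall>i\<ge>i0. (\<forall>k. \<P>(\<omega> in \<Omega>. K i i \<omega> = k) = dist0 k i) \<and>
      (\<forall>t\<ge>i. \<forall>k l. \<P>(\<omega> in \<Omega>. K i t \<omega> = k) > 0 \<longrightarrow>
        \<P>(\<omega> in \<Omega>. K i (Suc t) \<omega> = l \<bar> K i t \<omega> = k)
          = (if l = Suc k then f t k else if l = k then 1 - f t k else 0))"
    by (elim exE conjE) (rule that)
  show thesis
  proof (rule that[of i0])
    show "i0 \<ge> 1" by (rule i0(1))
    show "0 < f t k \<and> f t k < 1" if "t \<ge> i0" for t k using i0(2) that by blast
  qed (use ch in \<open>simp_all\<close>)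
qed

text \<open>Induction on the state: the inflow \<open>f t k * S k t\<close> into
  \<open>Suc k\<close> equals \<open>(t * f t k) * (S k t / t)\<close> for \<open>t > 0\<close>, so
  its limit is known once state \<open>k\<close> is settled, and
  \<open>tendsto_div_linear_recurrence\<close> applies.\<close>

lemma mean_degree_prob_tendsto:
  assumes net: "non_multiple_growing_network \<Omega> K dist0 f"
    and d: "\<And>k. (\<lambda>i. dist0 k i) \<longlonglongrightarrow> d k"
    and F: "\<And>k. (\<lambda>t. real t * f t k) \<longlonglongrightarrow> F k"
    and Fnn: "\<And>k. F k \<ge> 0"
  shows "mean_degree_prob \<Omega> K k \<longlonglongrightarrow> steady_weight d F k"
proof -
  interpret prob_space \<Omega>
    using net unfolding non_multiple_growing_network_def by (rule conjunct1)
  obtain i0 where "i0 \<ge> 1" and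
    fb: "\<And>t k. t \<ge> i0 \<Longrightarrow> 0 < f t k \<and> f t k < 1" and
    init: "\<And>i k. i \<ge> i0 \<Longrightarrow> \<P>(\<omega> in \<Omega>. K i i \<omega> = k) = dist0 k i" and
    trans: "\<And>i t k l. i \<ge> i0 \<Longrightarrow> t \<ge> i \<Longrightarrow> \<P>(\<omega> in \<Omega>. K i t \<omega> = k) > 0 \<Longrightarrow>
      \<P>(\<omega> in \<Omega>. K i (Suc t) \<omega> = l \<bar> K i t \<omega> = k)
        = (if l = Suc k then f t k else if l = k then 1 - f t k else 0)"
    by (rule non_multiple_growing_networkE[OF net]) (rule that)
  have meas: "K i t \<in> measurable \<Omega> (count_space UNIV)" if "i \<ge> 1" "t \<ge> i" for i t
    using net[unfolded non_multiple_growing_network_def, THEN conjunct2, THEN conjunct1] that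
    unfolding markov_chain_from_def by blast
  define p where "p k i t = \<P>(\<omega> in \<Omega>. K i t \<omega> = k)" for k i t
  \<comment> \<open>Only chains started at \<open>i0\<close> or later have the prescribed law, so
    the others are split off here.\<close>
  define S where "S k t = (\<Sum>i=i0..t. p k i t)" for k t
  have step: "p k i (Suc t) = (1 - f t k) * p k i t + (case k of 0 \<Rightarrow> 0 | Suc j \<Rightarrow> f t j * p j i t)"
    if "i \<ge> i0" "t \<ge> i" for k i t
    unfolding p_def using that \<open>i0 \<ge> 1\<close>
    by (intro prob_growth_step meas trans) auto
  have Srec: "S k (Suc t) = (1 - f t k) * S k t +
      ((case k of 0 \<Rightarrow> 0 | Suc j \<Rightarrow> f t j * S j t) + dist0 k (Suc t))" if "t \<ge> i0" for k t
  proof -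
    \<comment> \<open>The chain born at time \<open>Suc t\<close> contributes just its initial
      distribution.\<close>
    have "S k (Suc t) = (\<Sum>i=i0..t. p k i (Suc t)) + dist0 k (Suc t)"
      using that init[of "Suc t" k] by (simp add: S_def p_def)
    also have "(\<Sum>i=i0..t. p k i (Suc t)) =
        (\<Sum>i=i0..t. (1 - f t k) * p k i t + (case k of 0 \<Rightarrow> 0 | Suc j \<Rightarrow> f t j * p j i t))"
      by (intro sum.cong refl step) auto
    also have "\<dots> = (1 - f t k) * S k t + (case k of 0 \<Rightarrow> 0 | Suc j \<Rightarrow> f t j * S j t)"
      by (cases k) (simp_all add: S_def sum.distrib sum_distrib_left)
    finally show ?thesis by simp
  qed
  have Slim: "(\<lambda>t. S k t / real t) \<longlonglongrightarrow> steady_weight d F k" for k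
  proof (induction k)
    case 0
    show ?case unfolding steady_weight.simps
      by (rule tendsto_div_linear_recurrence[where T = i0 and f = "\<lambda>t. f t 0"
            and b = "\<lambda>t. dist0 0 (Suc t)"])
        (use Srec[of _ 0] fb[of _ 0] F Fnn d in \<open>auto intro: LIMSEQ_Suc less_imp_le\<close>)
  next
    case (Suc k)
    have "(\<lambda>t. real t * f t k * (S k t / real t) + dist0 (Suc k) (Suc t))
        \<longlonglongrightarrow> F k * steady_weight d F k + d (Suc k)"
      by (intro tendsto_intros F Suc.IH LIMSEQ_Suc d)
    moreover have "\<forall>\<^sub>F t in sequentially. real t * f t k * (S k t / real t) + dist0 (Suc k) (Suc t) =
        f t k * S k t + dist0 (Suc k) (Suc t)"
      using eventually_gt_at_top[of 0] by eventually_elim simp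
    ultimately have "(\<lambda>t. f t k * S k t + dist0 (Suc k) (Suc t))
        \<longlonglongrightarrow> F k * steady_weight d F k + d (Suc k)"
      by (rule Lim_transform_eventually)
    then show ?case unfolding steady_weight.simps
      by (intro tendsto_div_linear_recurrence[where T = i0 and f = "\<lambda>t. f t (Suc k)"
            and b = "\<lambda>t. f t k * S k t + dist0 (Suc k) (Suc t)"])
        (use Srec[of _ "Suc k"] fb[of _ "Suc k"] F Fnn in \<open>auto intro: less_imp_le\<close>)
  qed
  \<comment> \<open>Fewer than \<open>i0\<close> early chains, each contributing at most 1, vanish
    in the average.\<close>
  have "(\<lambda>t. (\<Sum>i=1..<i0. p k i t) / real t) \<longlonglongrightarrow> 0"
  proof (rule tendsto_0_le[of "\<lambda>t. 1 / real t" _ _ "real i0"])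
    show "(\<lambda>t. 1 / real t) \<longlonglongrightarrow> 0" by (rule lim_1_over_n)
    have "\<bar>\<Sum>i=1..<i0. p k i t\<bar> \<le> real i0" for t
    proof -
      have "(\<Sum>i=1..<i0. p k i t) \<le> (\<Sum>i=1..<i0. 1)"
        by (intro sum_mono) (simp add: p_def)
      moreover have "(\<Sum>i=1..<i0. p k i t) \<ge> 0" by (intro sum_nonneg) (simp add: p_def)
      ultimately show ?thesis by simp
    qed
    then show "\<forall>\<^sub>F t in sequentially. norm ((\<Sum>i=1..<i0. p k i t) / real t) \<le> norm (1 / real t) * real i0"
      by (auto simp: divide_right_mono)
  qed
  from tendsto_add[OF this Slim]
  have "(\<lambda>t. (\<Sum>i=1..<i0. p k i t) / real t + S k t / real t) \<longlonglongrightarrow> steady_weight d F k" by simp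
  moreover have "\<forall>\<^sub>F t in sequentially.
      (\<Sum>i=1..<i0. p k i t) / real t + S k t / real t = mean_degree_prob \<Omega> K k t"
    using eventually_ge_at_top[of i0]
  proof eventually_elim
    case (elim t)
    have "{1..t} = {1..<i0} \<union> {i0..t}" using elim \<open>i0 \<ge> 1\<close> by auto
    then have "(\<Sum>i=1..t. p k i t) = (\<Sum>i=1..<i0. p k i t) + S k t"
      unfolding S_def by (simp add: sum.union_disjoint ivl_disj_int)
    then show ?case by (simp add: mean_degree_prob_def p_def add_divide_distrib)
  qed
  ultimately show ?thesis by (rule Lim_transform_eventually)
qed

section \<open>Signs of the constants, closed forms and tail behaviour\<close>

theorem theorem2p5:
  fixes \<Omega> :: "'a measure"
    and K :: "nat \<Rightarrow> nat \<Rightarrow> 'a \<Rightarrow> nat"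
    and dist0 f :: "nat \<Rightarrow> nat \<Rightarrow> real"
    and d F P :: "nat \<Rightarrow> real"
    and m M :: nat
    and A B :: real
  assumes "P = degree_distribution \<Omega> K"
    and "non_multiple_growing_network \<Omega> K dist0 f"
    and "\<And>k. (\<lambda>i. dist0 k i) \<longlonglongrightarrow> d k"
    and "d sums 1"
    and "\<And>k. (\<lambda>t. real t * f t k) \<longlonglongrightarrow> F k"
    and "\<And>k. k < m \<Longrightarrow> d k = 0"
    and "d m > 0"
    and "\<And>k. k \<ge> m \<Longrightarrow> F k > 0"
    and "M \<ge> m"
    and "\<And>k. k > M \<Longrightarrow> d k = 0"
    and "\<And>k. F k = A * real k + B"
  shows
    "(steady_degree_distribution \<Omega> K P \<and> (\<lambda>k. P (m + k)) sums 1) \<and>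
     (A > 0 \<longrightarrow>
       scale_free \<Omega> K \<and>
       P m = d m / (1 + A * real m + B) \<and>
       (\<forall>k. m < k \<and> k \<le> M \<longrightarrow>
          P k = (\<Prod>i=m..<k. (A * real i + B) / (1 + A * (real i + 1) + B)) *
                (d m / (1 + A * real m + B) +
                 (\<Sum>l=m..<k. (d (l + 1) / (1 + A * (real l + 1) + B)) /
                    (\<Prod>j=m..l. (A * real j + B) / (1 + A * (real j + 1) + B))))) \<and>
       (\<forall>k. k > M \<longrightarrow>
          P k = Gamma (real k + B / A) / Gamma (real k + B / A + 1 + 1 / A) *
                (Gamma (real M + B / A + 1 + 1 / A) / Gamma (real M + B / A)) *
                (\<Prod>i=m..<M. (A * real i + B) / (1 + A * (real i + 1) + B)) *
                (d m / (1 + A * real m + B) +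
                 (\<Sum>l=m..<M. (d (l + 1) / (1 + A * (real l + 1) + B)) /
                    (\<Prod>j=m..l. (A * real j + B) / (1 + A * (real j + 1) + B))))) \<and>
       power_law P (1 + 1 / A)) \<and>
     (A > 0 \<and> d m = 1 \<and> (\<forall>k. k \<noteq> m \<longrightarrow> d k = 0) \<longrightarrow>
       P m = 1 / (1 + A * real m + B) \<and>
       (\<forall>k. k > m \<longrightarrow>
          P k = Gamma (real k + B / A) / Gamma (real k + B / A + 1 + 1 / A) *
                (Gamma (real m + B / A + 1 + 1 / A) / Gamma (real m + B / A)) *
                (1 / (1 + A * real m + B))) \<and>
       power_law P (1 + 1 / A)) \<and>
     (A = 0 \<and> B > 0 \<longrightarrow> \<not> scale_free \<Omega> K) \<and>
     (\<not> A < 0 \<and> \<not> (A = 0 \<and> B < 0))"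
proof -
  note P_def = assms(1) and net = assms(2) and dlim = assms(3) and dsum = assms(4) and Flim = assms(5)
    and d0 = assms(6) and dm = assms(7) and Fpos = assms(8) and mM = assms(9) and dM = assms(10)
    and Flin = assms(11)
  interpret prob_space \<Omega>
    using net unfolding non_multiple_growing_network_def by (rule conjunct1)
  obtain i0 where
    fb: "\<And>t k. t \<ge> i0 \<Longrightarrow> 0 < f t k \<and> f t k < 1" and
    init: "\<And>i k. i \<ge> i0 \<Longrightarrow> \<P>(\<omega> in \<Omega>. K i i \<omega> = k) = dist0 k i"
    by (rule non_multiple_growing_networkE[OF net]) (rule that)
  have Fnn: "F k \<ge> 0" for k
    using Flim[of k]
    by (rule LIMSEQ_le_const) (use fb in \<open>meson less_imp_le mult_nonneg_nonneg of_nat_0_le_iff\<close>)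
  have dnn: "d k \<ge> 0" for k
    using dlim[of k] by (rule LIMSEQ_le_const) (auto intro!: exI[of _ i0] simp: init[symmetric])
  \<comment> \<open>The linear formula holds at every \<open>k\<close>, even below \<open>m\<close>,
    so it may be evaluated at 0.\<close>
  have "B \<ge> 0" using Fnn[of 0] by (simp add: Flin)
  have "A \<ge> 0"
  proof (rule ccontr)
    assume "\<not> A \<ge> 0"
    \<comment> \<open>With a negative slope, \<open>F\<close> would become negative beyond
      \<open>B / (- A)\<close>.\<close>
    then obtain n where "real n * (- A) > B" using reals_Archimedean3[of "- A"] by auto
    then show False using Fnn[of n] by (simp add: Flin algebra_simps)
  qed
  have AB: "A * real m + B > 0" using Fpos[of m] by (simp add: Flin)
  have F_eq: "F = (\<lambda>k. A * real k + B)" using Flin by auto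
  have lim: "mean_degree_prob \<Omega> K k \<longlonglongrightarrow> steady_weight d F k" for k
    by (rule mean_degree_prob_tendsto[OF net dlim Flim Fnn])
  have P: "P = steady_weight d F"
    using lim by (auto simp: P_def degree_distribution_def fun_eq_iff intro: limI)
  have Psums: "P sums 1" unfolding P
    using not_summable_inverse_linear[OF \<open>A \<ge> 0\<close> \<open>B \<ge> 0\<close>]
    by (intro steady_weight_sums Fnn dnn dsum) (simp add: F_eq)
  have steady: "steady_degree_distribution \<Omega> K P"
    using lim Psums steady_weight_nonneg[of F d, OF Fnn dnn]
    by (simp add: steady_degree_distribution_def P)
  have "(\<Sum>k<m. P k) = 0" using steady_weight_eq_0[of m d _ F] d0 by (simp add: P)
  with Psums have Pm_sums: "(\<lambda>k. P (m + k)) sums 1"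
    using sums_iff_shift[of P m 1] by (simp add: add.commute)
  have Pm: "P m = d m / (1 + A * real m + B)"
    using steady_weight_first[of m d F] d0 by (simp add: P F_eq add.assoc)
  let ?q = "\<lambda>i. (A * real i + B) / (1 + A * (real i + 1) + B)"
  let ?R = "\<lambda>k. (\<Prod>i=m..<k. ?q i) * (d m / (1 + A * real m + B) +
      (\<Sum>l=m..<k. (d (l + 1) / (1 + A * (real l + 1) + B)) / (\<Prod>j=m..l. ?q j)))"
  have q: "F i / (1 + F (Suc i)) = ?q i" "1 + F (Suc i) = 1 + A * (real i + 1) + B" for i
    by (simp_all add: F_eq algebra_simps)
  have Pform: "P k = ?R k" if "m \<le> k" for k
    using steady_weight_product_formula[of m F d k] Fpos d0 that
    unfolding P q by (simp add: F_eq add.assoc)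
  have Ppos: "P k > 0" if "m \<le> k" for k
    using that
  proof (induction k rule: dec_induct)
    case base
    show ?case using Pm dm AB by simp
  next
    case (step n)
    then show ?case using Fpos[of n] Fpos[of "Suc n"] dnn[of "Suc n"]
      by (auto simp: P intro!: divide_pos_pos add_pos_nonneg)
  qed
  \<comment> \<open>The base point \<open>n\<close> is kept free: it will be \<open>M\<close> in
    general and \<open>m\<close> when all mass of \<open>d\<close> sits at \<open>m\<close>.\<close>
  have Ptail: "P k = (\<Prod>i=n..<k. ?q i) * P n" if "n \<le> k" "\<And>k. k > n \<Longrightarrow> d k = 0" for n k
    using steady_weight_product_tail[of n d k F] that by (simp add: P q(1))
  let ?G = "\<lambda>n k. Gamma (real k + B / A) / Gamma (real k + B / A + 1 + 1 / A) *
      (Gamma (real n + B / A + 1 + 1 / A) / Gamma (real n + B / A))"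
  have PGamma: "P k = ?G n k * P n" if "A > 0" "m \<le> n" "n \<le> k" "\<And>k. k > n \<Longrightarrow> d k = 0" for n k
  proof -
    have "A * real n + B > 0" using Fpos[OF \<open>m \<le> n\<close>] by (simp add: Flin)
    from prod_linear_eq_Gamma[OF \<open>A > 0\<close> this \<open>n \<le> k\<close>] Ptail[OF that(3,4)] show ?thesis
      by (simp add: algebra_simps)
  qed
  have pl: "power_law P (1 + 1 / A)" if "A > 0"
  proof -
    \<comment> \<open>The factor of \<open>PGamma\<close> at base \<open>M\<close> that does not
      depend on \<open>k\<close>; \<open>Ppos\<close> makes it positive.\<close>
    define C where "C = Gamma (real M + B / A + 1 + 1 / A) / Gamma (real M + B / A) * P M"
    have "A * real M + B > 0" using Fpos[OF mM] by (simp add: Flin)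
    then have "real M + B / A > 0" using that by (simp add: field_simps)
    moreover from this have "real M + B / A + 1 + 1 / A > 0" using that by (smt (verit) divide_pos_pos)
    ultimately have "C > 0" using Ppos[OF mM] by (simp add: C_def Gamma_real_pos)
    then have "power_law (\<lambda>k. Gamma (real k + B / A) / Gamma (real k + (B / A + 1 + 1 / A)) * C)
        ((B / A + 1 + 1 / A) - B / A)"
      using that \<open>B \<ge> 0\<close> by (intro power_law_Gamma_quotient) auto
    moreover have "\<forall>\<^sub>F k in sequentially.
        P k = Gamma (real k + B / A) / Gamma (real k + (B / A + 1 + 1 / A)) * C"
      using eventually_ge_at_top[of M]
    proof eventually_elim
      case (elim k)
      from PGamma[OF that mM elim dM] show ?case
        by (simp only: C_def add.assoc mult.assoc)
    qed
    ultimately show ?thesis by (simp add: power_law_cong)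
  qed
  have not_sf: "\<not> scale_free \<Omega> K" if "A = 0" "B > 0"
  proof
    assume "scale_free \<Omega> K"
    then obtain P' \<gamma> where P': "steady_degree_distribution \<Omega> K P'" "power_law P' \<gamma>"
      by (auto simp: scale_free_def)
    \<comment> \<open>Uniqueness of limits rules out any other candidate distribution.\<close>
    have "P' = P"
      using P'(1) steady by (auto simp: steady_degree_distribution_def fun_eq_iff intro: LIMSEQ_unique)
    \<comment> \<open>For \<open>A = 0\<close> every ratio \<open>?q i\<close> equals this constant,
      so the tail is geometric.\<close>
    define r where "r = B / (1 + B)"
    have r: "0 < r" "r < 1" using that by (auto simp: r_def)
    have "\<forall>\<^sub>F k in sequentially. P k = r ^ k * (P M / r ^ M)"
      using eventually_ge_at_top[of M]
    proof eventually_elim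
      case (elim k)
      from Ptail[OF elim dM] show ?case
        using r elim by (simp add: that(1) r_def[symmetric] power_diff)
    qed
    then have "power_law P \<gamma> \<longleftrightarrow> power_law (\<lambda>k. r ^ k * (P M / r ^ M)) \<gamma>"
      by (rule power_law_cong)
    with not_power_law_geometric[OF r] P'(2) \<open>P' = P\<close> show False by blast
  qed
  have II: "scale_free \<Omega> K \<and> P m = d m / (1 + A * real m + B) \<and>
      (\<forall>k. m < k \<and> k \<le> M \<longrightarrow> P k = ?R k) \<and>
      (\<forall>k. k > M \<longrightarrow> P k = ?G M k * (\<Prod>i=m..<M. ?q i) *
        (d m / (1 + A * real m + B) +
          (\<Sum>l=m..<M. (d (l + 1) / (1 + A * (real l + 1) + B)) / (\<Prod>j=m..l. ?q j)))) \<and>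
      power_law P (1 + 1 / A)" if "A > 0"
  proof (intro conjI allI impI)
    show "P m = d m / (1 + A * real m + B)" by (rule Pm)
    show "power_law P (1 + 1 / A)" by (rule pl[OF that])
    show "scale_free \<Omega> K" using steady pl[OF that] by (auto simp: scale_free_def)
    show "P k = ?R k" if "m < k \<and> k \<le> M" for k by (rule Pform) (use that in simp)
    fix k assume "k > M"
    then have "M \<le> k" by simp
    from PGamma[OF that mM this dM] have "P k = ?G M k * ?R M" by (simp only: Pform[OF mM])
    then show "P k = ?G M k * (\<Prod>i=m..<M. ?q i) *
        (d m / (1 + A * real m + B) +
          (\<Sum>l=m..<M. (d (l + 1) / (1 + A * (real l + 1) + B)) / (\<Prod>j=m..l. ?q j)))"
      by (simp only: mult.assoc)
  qed
  have II': "P m = 1 / (1 + A * real m + B) \<and>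
      (\<forall>k. k > m \<longrightarrow> P k = ?G m k * (1 / (1 + A * real m + B))) \<and> power_law P (1 + 1 / A)"
    if "A > 0 \<and> d m = 1 \<and> (\<forall>k. k \<noteq> m \<longrightarrow> d k = 0)"
  proof (intro conjI allI impI)
    show 1: "P m = 1 / (1 + A * real m + B)" using that by (simp only: Pm)
    show "power_law P (1 + 1 / A)" using that by (blast intro: pl)
    fix k assume "k > m"
    \<comment> \<open>Here \<open>d\<close> vanishes beyond \<open>m\<close>, so \<open>m\<close>
      serves as base point even if \<open>M\<close> is larger.\<close>
    with that have "P k = ?G m k * P m" by (intro PGamma) auto
    then show "P k = ?G m k * (1 / (1 + A * real m + B))" by (simp only: 1)
  qed
  have IV: "\<not> A < 0 \<and> \<not> (A = 0 \<and> B < 0)" using \<open>A \<ge> 0\<close> \<open>B \<ge> 0\<close> by simp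
  show ?thesis
    by (rule conjI[OF conjI[OF steady Pm_sums]], rule conjI, rule impI, erule II,
        rule conjI, rule impI, erule II', rule conjI[OF _ IV]) (use not_sf in blast)
qed

end
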